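(* For all integers $n\ge 1$ and $\alpha\ge 0$, $$C_n=\sum_{j=1}^{n}C_{n-j}\,\frac{3j-n-\alpha-2}{j}\binom{n+\alpha-j+1}{j-1}(-1)^j-\frac{2n-\alpha-1}{n}\binom{\alpha}{n-1}(-1)^n.$$
   Context: $C_n=\frac{1}{n+1}\binom{2n}{n}$ denotes the $n$-th Catalan number. Binomial coefficients $\binom{a}{b}$ with $b>a\ge 0$ are $0$. *)

theory Defs
  imports Complex_Main
begin

definition catalan :: "nat \<Rightarrow> real" where
  "catalan n = 1 / (real n + 1) * real ((2 * n) choose n)"

end

theory Submission
  imports Defs "HOL-Computational_Algebra.Polynomial"
begin

text \<open>
  Write \<open>N = n + \<alpha> + 1 - j\<close>.  Since \<open>j (N choose j) = (N - j + 1) (N choose (j - 1))\<close>,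
  the coefficient of \<open>C\<^bsub>n-j\<^esub>\<close> in the sum is, up to sign,
  the difference \<open>(N choose (j - 1)) - (N choose j)\<close>, and the term outside the sum is such a
  difference as well.  With \<open>m = n - j\<close> the two halves of the sum are, apart from one boundary
  term \<open>C\<^bsub>n\<^esub>\<close>, instances (for \<open>n - 1\<close> and for \<open>n\<close>) of the convolution
  \<open>\<Sum>m\<le>n. (-1)\<^sup>m C\<^sub>m (m + \<alpha> + 1 choose n - m) = (\<alpha> choose n)\<close>,
  which is lemma \<open>catalan_convolution\<close>.

  In terms of the generating function \<open>C(x)\<close> of the Catalan numbers, that convolution is the
  functional equation \<open>(1 - x) C(x (1 - x)) = 1\<close> multiplied by \<open>(1 - x)\<^sup>\<alpha>\<close>.
  Accordingly, for \<open>n \<ge> 1\<close>, both sides satisfy the same Pascal recurrence in \<open>\<alpha>\<close>, and only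
  \<open>\<alpha> = 0\<close> needs a fact about Catalan numbers
  (lemma \<open>catalan_convolution_zero\<close>).  There, for \<open>n \<ge> 1\<close>, the summands can be rewritten as
  \<open>(n choose m) (2m choose (n - 1)) / n\<close>, so that the sum is an \<open>n\<close>-th finite difference of a
  polynomial of degree \<open>n - 1\<close> and vanishes.
\<close>

text \<open>
  The sum is the coefficient of \<open>x\<^sup>n\<close> in
  \<open>(1 - (1 + x)\<^sup>2)\<^bsup>n+1\<^esup>\<close>, and \<open>x\<close> divides \<open>1 - (1 + x)\<^sup>2\<close>.
\<close>

lemma alternating_sum_choose_double:
  "(\<Sum>m\<le>Suc n. (- 1) ^ m * real (Suc n choose m) * real ((2 * m) choose n)) = 0"
proof -
  let ?q = "[:1, 1:] :: real poly"
  have coeff_q: "coeff (?q ^ k) i = real (k choose i)" for k i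
  proof (cases "i \<le> k")
    case True
    then show ?thesis by (simp add: coeff_linear_poly_power)
  next
    case False
    moreover have "degree (?q ^ k) \<le> k"
      using degree_power_le[of ?q k] by simp
    ultimately show ?thesis by (simp add: coeff_eq_0)
  qed
  have factor: "- (?q ^ 2) + 1 = monom 1 1 * [:-2, -1:]"
    by (simp add: power2_eq_square monom_altdef one_pCons)
  have "(- (?q ^ 2) + 1) ^ Suc n
      = (\<Sum>m\<le>Suc n. of_nat (Suc n choose m) * (- (?q ^ 2)) ^ m)"
    by (simp only: binomial_ring power_one mult_1_right)
  also have "\<dots> = (\<Sum>m\<le>Suc n. smult ((- 1) ^ m * real (Suc n choose m)) (?q ^ (2 * m)))"
  proof (rule sum.cong)
    fix m
    have "(- (?q ^ 2)) ^ m = smult ((- 1) ^ m) (?q ^ (2 * m))"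
      using smult_power[of "- 1" "?q ^ 2" m] by (simp add: power_mult)
    then show "of_nat (Suc n choose m) * (- (?q ^ 2)) ^ m
        = smult ((- 1) ^ m * real (Suc n choose m)) (?q ^ (2 * m))"
      by (simp only: of_nat_mult_conv_smult smult_smult mult.commute)
  qed simp
  finally have expand: "(- (?q ^ 2) + 1) ^ Suc n
      = (\<Sum>m\<le>Suc n. smult ((- 1) ^ m * real (Suc n choose m)) (?q ^ (2 * m)))" .
  have "coeff ((- (?q ^ 2) + 1) ^ Suc n) n = 0"
    unfolding factor power_mult_distrib monom_power by (simp add: coeff_monom_mult)
  then show ?thesis
    unfolding expand coeff_sum coeff_smult coeff_q .
qed

text \<open>
  If \<open>n \<le> 2m\<close>, both sides are
  \<open>(n + 1) (2m)! / (m! (n + 1 - m)! (2m - n)!)\<close>; otherwise both vanish.  The gain is that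
  \<open>m\<close> now enters only through \<open>Suc n choose m\<close> and a polynomial in \<open>m\<close> of degree \<open>n\<close>,
  which makes the alternating sum over \<open>m\<close> a finite difference.
\<close>

lemma catalan_times_choose:
  assumes "m \<le> Suc n"
  shows "real (Suc n) * (catalan m * real (Suc m choose (Suc n - m)))
    = real (Suc n choose m) * real ((2 * m) choose n)"
proof (cases "n \<le> 2 * m")
  case False
  then show ?thesis by (simp add: binomial_eq_0)
next
  case True
  define k where "k = 2 * m - n"
  define l where "l = Suc n - m"
  have k: "2 * m = n + k" and l: "Suc n = m + l"
    using True assms by (simp_all add: k_def l_def)
  have lk: "Suc m = l + k" using k l by linarith
  have A: "real ((2 * m) choose m) = fact (2 * m) / (fact m * fact m)"
    using binomial_fact[of m "2 * m", where 'a = real] by simp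
  have B: "real (Suc m choose l) = fact (Suc m) / (fact l * fact k)"
    using binomial_fact[of l "Suc m", where 'a = real] lk by simp
  have C: "real (Suc n choose m) = fact (Suc n) / (fact m * fact l)"
    using binomial_fact[of m "Suc n", where 'a = real] l by simp
  have D: "real ((2 * m) choose n) = fact (2 * m) / (fact n * fact k)"
    using binomial_fact[of n "2 * m", where 'a = real] k by simp
  have "catalan m * fact (Suc m) = fact (2 * m) / fact m"
    unfolding catalan_def A fact_Suc[of m] by (simp add: divide_simps)
  moreover have "fact (Suc n) = real (Suc n) * fact n"
    by simp
  ultimately show ?thesis
    unfolding l_def[symmetric] B C D by (simp add: field_simps del: fact_Suc of_nat_Suc)
qed

text \<open>
  This is the coefficient form of \<open>(1 - x) C(x (1 - x)) = 1\<close>, with \<open>x\<close> replaced by \<open>-x\<close>.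
\<close>

lemma catalan_convolution_zero:
  "(\<Sum>m\<le>n. (- 1) ^ m * catalan m * real (Suc m choose (n - m))) = real (0 choose n)"
proof (cases n)
  case 0
  then show ?thesis by (simp add: catalan_def)
next
  case (Suc k)
  have "real (Suc k) * (\<Sum>m\<le>Suc k. (- 1) ^ m * catalan m * real (Suc m choose (Suc k - m)))
      = (\<Sum>m\<le>Suc k. (- 1) ^ m
          * (real (Suc k) * (catalan m * real (Suc m choose (Suc k - m)))))"
    unfolding sum_distrib_left by (simp only: mult_ac)
  also have "\<dots> = (\<Sum>m\<le>Suc k. (- 1) ^ m * real (Suc k choose m) * real ((2 * m) choose k))"
    by (rule sum.cong) (simp_all only: catalan_times_choose atMost_iff mult.assoc)
  also have "\<dots> = 0"
    by (rule alternating_sum_choose_double)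
  finally show ?thesis using Suc by simp
qed

lemma catalan_convolution:
  "(\<Sum>m\<le>n. (- 1) ^ m * catalan m * real ((m + \<alpha> + 1) choose (n - m))) = real (\<alpha> choose n)"
proof (induction \<alpha> arbitrary: n)
  case 0
  then show ?case using catalan_convolution_zero[of n] by simp
next
  case (Suc \<alpha>)
  show ?case
  proof (cases n)
    case 0
    then show ?thesis by (simp add: catalan_def)
  next
    case (Suc k)
    let ?s = "\<lambda>i m. (- 1) ^ m * catalan m * real ((m + \<alpha> + 1) choose i)"
    have pascal: "(- 1) ^ m * catalan m * real ((m + Suc \<alpha> + 1) choose (Suc k - m))
        = ?s (Suc k - m) m + ?s (k - m) m" if "m \<le> k" for m
      using that by (simp add: Suc_diff_le distrib_left)
    have "(\<Sum>m\<le>Suc k. (- 1) ^ m * catalan m * real ((m + Suc \<alpha> + 1) choose (Suc k - m)))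
        = (\<Sum>m\<le>Suc k. ?s (Suc k - m) m) + (\<Sum>m\<le>k. ?s (k - m) m)"
      unfolding sum.atMost_Suc using sum.cong[OF refl pascal, of "{..k}"]
      by (simp add: sum.distrib del: add_Suc_right)
    also have "\<dots> = real (\<alpha> choose Suc k) + real (\<alpha> choose k)"
      by (simp only: Suc.IH)
    finally show ?thesis using Suc by simp
  qed
qed

text \<open>
  The weight equals \<open>1 - (N - j + 1) / j\<close>, and \<open>(N - j + 1) / j\<close> is the ratio of the consecutive
  binomial coefficients.  Both weights of the theorem have this form: inside the sum
  \<open>N = n + \<alpha> + 1 - j\<close>, outside it \<open>N = \<alpha>\<close> and \<open>j = n\<close>.
\<close>

lemma weighted_choose_eq_diff:
  assumes "j \<ge> 1"
  shows "(2 * real j - 1 - real N) / real j * real (N choose (j - 1))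
    = real (N choose (j - 1)) - real (N choose j)"
proof -
  obtain i where j: "j = Suc i" using assms by (cases j) auto
  have "real N * real (N choose i) = real i * real (N choose i) + real (Suc i) * real (N choose Suc i)"
    using gbinomial_mult_1[of "real N" i] by (simp add: binomial_gbinomial)
  then show ?thesis unfolding j by (simp add: field_simps)
qed

theorem mainTheorem4:
  fixes n \<alpha> :: nat
  assumes "n \<ge> 1"
  shows "catalan n =
    (\<Sum>j = 1..n. catalan (n - j) * ((3 * real j - real n - real \<alpha> - 2) / real j)
        * real ((n + \<alpha> - j + 1) choose (j - 1)) * (- 1) ^ j)
    - (2 * real n - real \<alpha> - 1) / real n * real (\<alpha> choose (n - 1)) * (- 1) ^ n"
proof -
  obtain p where n: "n = Suc p" using assms by (cases n) auto
  let ?s = "\<lambda>i m. (- 1) ^ m * catalan m * real ((m + \<alpha> + 1) choose i)"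
  let ?f = "\<lambda>j. catalan (n - j) * ((3 * real j - real n - real \<alpha> - 2) / real j)
        * real ((n + \<alpha> - j + 1) choose (j - 1)) * (- 1) ^ j"
  have summand: "?f (n - m) = (- 1) ^ n * (?s (p - m) m - ?s (n - m) m)" if "m \<le> p" for m
  proof -
    define j where "j = n - m"
    have j: "j \<ge> 1" "n = m + j" "j - 1 = p - m" using that by (simp_all add: j_def n)
    have "(3 * real j - real n - real \<alpha> - 2) / real j * real ((m + \<alpha> + 1) choose (j - 1))
        = (2 * real j - 1 - real (m + \<alpha> + 1)) / real j * real ((m + \<alpha> + 1) choose (j - 1))"
      by (simp add: j(2))
    also have "\<dots> = real ((m + \<alpha> + 1) choose (j - 1)) - real ((m + \<alpha> + 1) choose j)"
      by (rule weighted_choose_eq_diff[OF j(1)])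
    finally have coeff: "(3 * real j - real n - real \<alpha> - 2) / real j
          * real ((m + \<alpha> + 1) choose (j - 1))
        = real ((m + \<alpha> + 1) choose (j - 1)) - real ((m + \<alpha> + 1) choose j)" .
    have sign: "(- 1 :: real) ^ j = (- 1) ^ n * (- 1) ^ m"
      unfolding j(2) by (simp add: power_add mult.commute mult.left_commute)
    have "n - j = m" and "n + \<alpha> - j + 1 = m + \<alpha> + 1" using j by simp_all
    then have "?f j = catalan m * ((3 * real j - real n - real \<alpha> - 2) / real j
          * real ((m + \<alpha> + 1) choose (j - 1))) * (- 1) ^ j"
      by (simp only: mult.assoc)
    also have "\<dots> = (- 1) ^ n * (?s (j - 1) m - ?s j m)"
      unfolding coeff sign by (simp only: right_diff_distrib left_diff_distrib mult_ac)
    finally show ?thesis by (simp only: j_def[symmetric] j(3)[symmetric])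
  qed
  have "(\<Sum>j = 1..n. ?f j) = (\<Sum>m\<le>p. ?f (n - m))"
    by (rule sum.reindex_bij_witness[of _ "\<lambda>m. n - m" "\<lambda>j. n - j"]) (auto simp: n)
  also have "\<dots> = (\<Sum>m\<le>p. (- 1) ^ n * (?s (p - m) m - ?s (n - m) m))"
    by (rule sum.cong[OF refl], rule summand) simp
  also have "\<dots> = (- 1) ^ n * ((\<Sum>m\<le>p. ?s (p - m) m) - (\<Sum>m\<le>p. ?s (n - m) m))"
    by (simp only: sum_distrib_left[symmetric] sum_subtractf)
  also have "(\<Sum>m\<le>p. ?s (p - m) m) = real (\<alpha> choose p)"
    by (rule catalan_convolution)
  \<comment> \<open>The index \<open>m = n\<close> of the convolution belongs to \<open>j = 0\<close>, which the sum omits; hence \<open>C\<^bsub>n\<^esub>\<close>.\<close>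
  also have "(\<Sum>m\<le>p. ?s (n - m) m) = real (\<alpha> choose n) - (- 1) ^ n * catalan n"
    using catalan_convolution[where n = n and \<alpha> = \<alpha>] by (simp add: n)
  finally have sum: "(\<Sum>j = 1..n. ?f j)
      = (- 1) ^ n * (real (\<alpha> choose p) - real (\<alpha> choose n)) + catalan n"
    by (simp add: algebra_simps flip: power_add mult_2)
  have "(2 * real n - real \<alpha> - 1) / real n * real (\<alpha> choose (n - 1))
      = real (\<alpha> choose p) - real (\<alpha> choose n)"
    using weighted_choose_eq_diff[OF assms, of \<alpha>] by (simp add: n algebra_simps)
  then show ?thesis unfolding sum by simp
qed

end
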